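(* For any $0<\alpha,\beta<1$ and any positive integer $p$, there exist a graph $H$ and an edge $e\in E(H)$ such that $\mathrm{Z}_{\alpha,\beta}(H/e)-\mathrm{Z}_{\alpha,\beta}(H)\ge p$.
   Context: All graphs are finite and simple. For an edge $e=ab$ of $H$, $H/e$ denotes the contraction, obtained from $H$ by identifying $a$ and $b$ and suppressing any loops or multiple edges that result. Let $\alpha,\beta$ be the transmission proportion and the transmission threshold, let $G$ be a graph and $B\subseteq V(G)$ a set of initially filled vertices. The transmission forcing process started from $B$ is defined as follows. Put $B_0=B$, $w_0(v)=1$ for $v\in B$ and $w_0(v)=0$ for $v\in V(G)\setminus B$. For $t\ge 1$, given the set $B_{t-1}$ of vertices filled at time $t-1$ and the weights $w_{t-1}$: for each unfilled vertex $u\in V(G)\setminus B_{t-1}$ let $\mathcal V_{t,u}$ be the set of all $v\in B_{t-1}$ such that $u$ is the only neighbor of $v$ in $V(G)\setminus B_{t-1}$ and $v\notin \mathcal V_{s,u'}$ for every $s<t$ and every $u'$ (each vertex transmits weight at most once); when $v\in\mathcal V_{t,u}$ we say $v$ forces $u$, written $v\to u$. Set $w_t(u)=w_{t-1}(u)+\sum_{v\in\mathcal V_{t,u}}\alpha\, w_{t-1}(v)$ for $u\in V(G)\setminus B_{t-1}$ and $w_t(u)=w_{t-1}(u)$ for $u\in B_{t-1}$. Then $B_t=B_{t-1}\cup\{u\in V(G)\setminus B_{t-1} : w_t(u)\ge\beta\}$. The set $B$ is an $(\alpha,\beta)$-transmission zero forcing set of $G$ if $B_t=V(G)$ for some $t\ge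 0$, and the $(\alpha,\beta)$-transmission zero forcing number $\mathrm{Z}_{\alpha,\beta}(G)$ is the minimum cardinality of such a set. *)

theory Defs
  imports Complex_Main "Graph_Theory.Pair_Digraph"
begin

text \<open>
  Finite simple graphs are the locale \<open>pair_graph\<close>: an undirected edge \<open>ab\<close> is
  represented by the two arcs \<open>(a, b)\<close> and \<open>(b, a)\<close>.

  In the contraction, the endpoint \<open>a\<close> serves as the name of the merged vertex. Arcs whose
  ends are identified are dropped (no loops), and multiple edges collapse because arcs form a set.
\<close>

definition contract_edge :: "'a pair_pre_digraph \<Rightarrow> 'a \<times> 'a \<Rightarrow> 'a pair_pre_digraph" where
  "contract_edge H e =
    (let f = (\<lambda>x. if x = snd e then fst e else x) in
     \<lparr> pverts = f ` pverts H,
       parcs = {(f u, f v) | u v. (u, v) \<in> parcs H \<and> f u \<noteq> f v} \<rparr>)"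

lemma pair_graph_contract_edge:
  assumes "pair_graph H" "e \<in> parcs H"
  shows "pair_graph (contract_edge H e)"
proof -
  interpret pair_graph H by fact
  define f where "f = (\<lambda>x. if x = snd e then fst e else x)"
  have eq: "contract_edge H e =
    \<lparr> pverts = f ` pverts H, parcs = {(f u, f v) | u v. (u, v) \<in> parcs H \<and> f u \<noteq> f v} \<rparr>"
    by (simp add: contract_edge_def f_def Let_def)
  have sub: "{(f u, f v) | u v. (u, v) \<in> parcs H \<and> f u \<noteq> f v}
             \<subseteq> (\<lambda>(u, v). (f u, f v)) ` parcs H"
    by force
  have fin: "finite {(f u, f v) | u v. (u, v) \<in> parcs H \<and> f u \<noteq> f v}"
    using finite_subset[OF sub] pair_finite_arcs by blast
  have ends: "u \<in> pverts H \<and> v \<in> pverts H" if "(u, v) \<in> parcs H" for u v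
    using arc_fst_in_verts[OF that] arc_snd_in_verts[OF that] by simp
  have sym_H: "(v, u) \<in> parcs H" if "(u, v) \<in> parcs H" for u v
    using that by (rule arcs_symmetric)
  have sym: "sym {(f u, f v) | u v. (u, v) \<in> parcs H \<and> f u \<noteq> f v}"
  proof (rule symI)
    fix x y
    assume "(x, y) \<in> {(f u, f v) | u v. (u, v) \<in> parcs H \<and> f u \<noteq> f v}"
    then obtain u v where "x = f u" "y = f v" "(u, v) \<in> parcs H" "f u \<noteq> f v"
      by auto
    then show "(y, x) \<in> {(f u, f v) | u v. (u, v) \<in> parcs H \<and> f u \<noteq> f v}"
      using sym_H[of u v] by (intro CollectI exI[of _ v] exI[of _ u]) simp
  qed
  define K where
    "K = \<lparr> pverts = f ` pverts H, parcs = {(f u, f v) | u v. (u, v) \<in> parcs H \<and> f u \<noteq> f v} \<rparr>"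
  have "symmetric (with_proj K)"
    using sym by (simp add: symmetric_def K_def)
  moreover have "finite (pverts K)" "finite (parcs K)"
    using fin by (simp_all add: K_def)
  moreover have "fst a \<in> pverts K" "snd a \<in> pverts K" "fst a \<noteq> snd a" if "a \<in> parcs K" for a
    using that ends by (auto simp: K_def)
  ultimately have "pair_graph K"
    by unfold_locales
  then show ?thesis
    by (simp add: eq K_def)
qed


text \<open>
  \<open>tzf_forcers t u\<close> is the set of vertices forcing \<open>u\<close> at time \<open>t\<close>.
  Time \<open>0\<close> has no forces. The three functions at time \<open>t + 1\<close> refer to each other in the order
  forcers, weight, filled, as reflected in the termination measure.
\<close>

context
  fixes G :: "'a pair_pre_digraph" and \<alpha> \<beta> :: real and B :: "'a set"
begin

function tzf_filled :: "nat \<Rightarrow> 'a set"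
  and tzf_weight :: "nat \<Rightarrow> 'a \<Rightarrow> real"
  and tzf_forcers :: "nat \<Rightarrow> 'a \<Rightarrow> 'a set" where
  "tzf_filled 0 = B"
| "tzf_filled (Suc t) =
     tzf_filled t \<union> {u \<in> pverts G - tzf_filled t. tzf_weight (Suc t) u \<ge> \<beta>}"
| "tzf_weight 0 v = (if v \<in> B then 1 else 0)"
| "tzf_weight (Suc t) u =
     (if u \<in> pverts G - tzf_filled t
      then tzf_weight t u + (\<Sum>v\<in>tzf_forcers (Suc t) u. \<alpha> * tzf_weight t v)
      else tzf_weight t u)"
| "tzf_forcers 0 u = {}"
| "tzf_forcers (Suc t) u =
     {v \<in> tzf_filled t. {x \<in> pverts G - tzf_filled t. (v, x) \<in> parcs G} = {u} \<and>
                        (\<forall>s\<in>{..<Suc t}. \<forall>u'. v \<notin> tzf_forcers s u')}"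
  by pat_completeness auto

termination
  by (relation "measure (\<lambda>x. case x of Inl t \<Rightarrow> 3 * t + 2
                                      | Inr (Inl (t, _)) \<Rightarrow> 3 * t + 1
                                      | Inr (Inr (t, _)) \<Rightarrow> 3 * t)") auto

end

definition tzf_set :: "real \<Rightarrow> real \<Rightarrow> 'a pair_pre_digraph \<Rightarrow> 'a set \<Rightarrow> bool" where
  "tzf_set \<alpha> \<beta> G B \<longleftrightarrow> B \<subseteq> pverts G \<and> (\<exists>t. tzf_filled G \<alpha> \<beta> B t = pverts G)"

definition tzf_number :: "real \<Rightarrow> real \<Rightarrow> 'a pair_pre_digraph \<Rightarrow> nat" where
  "tzf_number \<alpha> \<beta> G = (LEAST k. \<exists>B. tzf_set \<alpha> \<beta> G B \<and> card B = k)"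

lemma tzf_number_attained: "\<exists>B. tzf_set \<alpha> \<beta> G B \<and> card B = tzf_number \<alpha> \<beta> G"
proof -
  have "tzf_filled G \<alpha> \<beta> (pverts G) 0 = pverts G"
    by (rule tzf_filled.simps(1))
  then have "tzf_set \<alpha> \<beta> G (pverts G)"
    unfolding tzf_set_def by blast
  then have "\<exists>k B. tzf_set \<alpha> \<beta> G B \<and> card B = k"
    by blast
  then show ?thesis
    unfolding tzf_number_def by (rule LeastI_ex)
qed

end

theory Submission
  imports Defs
begin

text \<open>
  Let \<open>H\<close> consist of two adjacent hubs, each carrying \<open>K\<close> pendant leaves and one pendant path with
  \<open>L\<close> vertices. Filling the \<open>2K\<close> leaves gives each hub weight \<open>K\<alpha>\<close>, which for large \<open>K\<close> suffices to
  fill both paths. After contracting the edge between the hubs, the merged hub transmits only once,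
  so all but at most one of the leaves are initially filled, and some path \<open>P\<close> receives nothing from
  the hub. The total weight \<open>W\<close> on \<open>P\<close> then satisfies \<open>W \<le> \<bar>B \<inter> P\<bar> + \<alpha>W\<close>, because every vertex passes
  on at most the fraction \<open>\<alpha>\<close> of its weight, while \<open>W \<ge> \<beta>L\<close> since \<open>P\<close> gets filled.
  Hence \<open>\<bar>B \<inter> P\<bar> \<ge> (1 - \<alpha>)\<beta>L\<close>, which is as large as desired.
\<close>

declare tzf_filled.simps(2) [simp del] tzf_weight.simps(2) [simp del] tzf_forcers.simps(2) [simp del]

section \<open>The transmission process\<close>

context
  fixes G :: "'a pair_pre_digraph" and \<alpha> \<beta> :: real and B :: "'a set"
begin

abbreviation "filled \<equiv> tzf_filled G \<alpha> \<beta> B"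
abbreviation "weight \<equiv> tzf_weight G \<alpha> \<beta> B"
abbreviation "forcers \<equiv> tzf_forcers G \<alpha> \<beta> B"

lemma tzf_filled_mono: "s \<le> t \<Longrightarrow> filled s \<subseteq> filled t"
  by (rule lift_Suc_mono_le[of filled]) (auto simp: tzf_filled.simps(2))

lemma tzf_filled_subset: "B \<subseteq> pverts G \<Longrightarrow> filled t \<subseteq> pverts G"
  by (induction t) (auto simp: tzf_filled.simps(2))

lemma tzf_forcersD:
  assumes "v \<in> forcers (Suc t) u"
  shows "v \<in> filled t" "u \<in> pverts G" "u \<notin> filled t" "(v, u) \<in> parcs G"
    "{x \<in> pverts G - filled t. (v, x) \<in> parcs G} = {u}"
    "\<And>s u'. s \<le> t \<Longrightarrow> v \<notin> forcers s u'"
  using assms by (auto simp: tzf_forcers.simps(2))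

lemma tzf_forcers_subset: "forcers (Suc t) u \<subseteq> filled t"
  using tzf_forcersD(1) by blast

text \<open>The guard in the process excludes two different times, and at one time the target is the
  sender's only unfilled neighbour.\<close>

lemma tzf_forcers_unique:
  assumes "v \<in> forcers s u" "v \<in> forcers t u'"
  shows "s = t \<and> u = u'"
proof (cases s; cases t)
  fix m n assume "s = Suc m" "t = Suc n"
  moreover from this assms have "\<not> s \<le> n" "\<not> t \<le> m"
    using tzf_forcersD(6) by blast+
  ultimately have "s = t" by simp
  then show ?thesis
    using assms tzf_forcersD(5)[of v m u] tzf_forcersD(5)[of v m u'] \<open>s = Suc m\<close> by auto
qed (use assms in auto)

text \<open>Only unfilled vertices have forcers, so for all others the sum is empty and the case
  distinction disappears.\<close>

lemma tzf_weight_Suc: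
  "weight (Suc t) u = weight t u + (\<Sum>v\<in>forcers (Suc t) u. \<alpha> * weight t v)"
proof (cases "u \<in> pverts G - filled t")
  case False
  then have "forcers (Suc t) u = {}"
    using tzf_forcersD(2,3) by blast
  then show ?thesis
    using False by (simp add: tzf_weight.simps(2))
qed (simp add: tzf_weight.simps(2))

lemma tzf_weight_nonneg: "0 \<le> \<alpha> \<Longrightarrow> 0 \<le> weight t u"
  by (induction t arbitrary: u) (auto simp: tzf_weight_Suc intro!: add_nonneg_nonneg sum_nonneg)

lemma tzf_weight_filled: "u \<in> filled s \<Longrightarrow> s \<le> t \<Longrightarrow> weight t u = weight s u"
proof (induction t)
  case (Suc t)
  show ?case
  proof (cases "s \<le> t")
    case True
    then have "u \<in> filled t"
      using Suc.prems(1) tzf_filled_mono by blast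
    then show ?thesis
      using Suc True by (simp add: tzf_weight.simps(2))
  qed (use Suc in \<open>auto simp: le_Suc_eq\<close>)
qed simp

lemma tzf_weight_initial: "u \<in> B \<Longrightarrow> weight t u = 1"
  using tzf_weight_filled[of u 0 t] by simp

text \<open>Initial vertices have weight 1, which is where \<open>\<beta> \<le> 1\<close> enters;
  later ones passed the threshold when filled.\<close>

lemma tzf_weight_ge_threshold: "\<beta> \<le> 1 \<Longrightarrow> u \<in> filled t \<Longrightarrow> \<beta> \<le> weight t u"
proof (induction t)
  case (Suc t)
  show ?case
  proof (cases "u \<in> filled t")
    case True
    then show ?thesis
      using Suc tzf_weight_filled[of u t "Suc t"] by simp
  qed (use Suc in \<open>auto simp: tzf_filled.simps(2)\<close>)
qed simp

lemma tzf_weight_pos_forced: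
  "u \<notin> B \<Longrightarrow> weight t u \<noteq> 0 \<Longrightarrow> \<exists>s v. v \<in> forcers s u"
proof (induction t)
  case (Suc t)
  then show ?case
    by (cases "forcers (Suc t) u = {}") (auto simp: tzf_weight_Suc)
qed simp

lemma tzf_filled_forced:
  "0 < \<beta> \<Longrightarrow> \<beta> \<le> 1 \<Longrightarrow> u \<in> filled t \<Longrightarrow> u \<notin> B \<Longrightarrow> \<exists>s v. v \<in> forcers s u"
  using tzf_weight_pos_forced[of u t] tzf_weight_ge_threshold[of u t] by force

lemma tzf_forcers_arc: "v \<in> forcers t u \<Longrightarrow> (v, u) \<in> parcs G"
  using tzf_forcersD(4) by (cases t) auto

text \<open>Each transmitted weight is charged to its unique sender, whose weight is final from the time
  at which it is filled.\<close>

lemma tzf_total_weight: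
  assumes "finite (pverts G)" "B \<subseteq> pverts G" "P \<subseteq> pverts G"
  shows "(\<Sum>u\<in>P. weight t u) =
    card (B \<inter> P) + \<alpha> * (\<Sum>v\<in>(\<Union>s\<le>t. \<Union>u\<in>P. forcers s u). weight t v)"
proof (induction t)
  case 0
  have "finite P" using assms by (blast intro: finite_subset)
  then show ?case by (simp add: sum.If_cases Int_commute)
next
  case (Suc t)
  define X where "X = (\<Union>s\<le>t. \<Union>u\<in>P. forcers s u)"
  define Y where "Y = (\<Union>u\<in>P. forcers (Suc t) u)"
  have finP: "finite P" using assms by (blast intro: finite_subset)
  have fint: "finite (filled t)"
    by (rule finite_subset[OF tzf_filled_subset]) (fact assms)+
  have Y: "Y \<subseteq> filled t"
    using tzf_forcers_subset by (auto simp: Y_def)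
  have finF: "finite (forcers (Suc t) u)" for u
    using tzf_forcers_subset fint by (rule finite_subset)
  have X: "X \<subseteq> filled t"
  proof
    fix v assume "v \<in> X"
    then obtain s u where "s \<le> t" "v \<in> forcers s u" by (auto simp: X_def)
    then show "v \<in> filled t"
      using tzf_forcersD(1)[of v "s - 1" u] tzf_filled_mono[of "s - 1" t] by (cases s) auto
  qed
  have finXY: "finite X" "finite Y"
    using X Y fint by (auto intro: finite_subset)
  have XY: "X \<inter> Y = {}"
    unfolding X_def Y_def using tzf_forcersD(6) by blast
  have new: "(\<Sum>v\<in>Y. weight t v) = (\<Sum>u\<in>P. \<Sum>v\<in>forcers (Suc t) u. weight t v)"
    unfolding Y_def
  proof (rule sum.UNION_disjoint[OF finP])
    show "\<forall>u\<in>P. \<forall>u'\<in>P. u \<noteq> u' \<longrightarrow> forcers (Suc t) u \<inter> forcers (Suc t) u' = {}"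
      using tzf_forcers_unique by blast
  qed (use finF in blast)
  \<comment> \<open>All senders so far are filled by time \<open>t\<close>, so their weights are
    final.\<close>
  have same: "(\<Sum>v\<in>X \<union> Y. weight (Suc t) v) = (\<Sum>v\<in>X \<union> Y. weight t v)"
    using X Y tzf_weight_filled[of _ t "Suc t"] by (intro sum.cong) auto
  have "(\<Sum>u\<in>P. weight (Suc t) u) = (\<Sum>u\<in>P. weight t u) + \<alpha> * (\<Sum>v\<in>Y. weight t v)"
    by (simp add: tzf_weight_Suc sum.distrib new sum_distrib_left)
  also have "\<dots> = card (B \<inter> P) + \<alpha> * (\<Sum>v\<in>X \<union> Y. weight t v)"
    using Suc by (simp add: sum.union_disjoint[OF finXY XY] X_def[symmetric] algebra_simps)
  also have "X \<union> Y = (\<Union>s\<le>Suc t. \<Union>u\<in>P. forcers s u)"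
    by (auto simp: X_def Y_def atMost_Suc)
  finally show ?case
    using same by (simp add: X_def Y_def atMost_Suc Un_commute)
qed

text \<open>By \<open>closed\<close>, every sender counted in \<open>tzf_total_weight\<close> lies
  in \<open>P\<close>, so their joint weight is at most the total weight of
  \<open>P\<close>.\<close>

lemma tzf_isolated_part_bound:
  assumes "finite (pverts G)" "B \<subseteq> pverts G" "P \<subseteq> filled t" "0 \<le> \<alpha>" "\<alpha> \<le> 1" "\<beta> \<le> 1"
    and closed: "\<And>s u v. u \<in> P \<Longrightarrow> v \<in> forcers s u \<Longrightarrow> v \<in> P"
  shows "(1 - \<alpha>) * \<beta> * card P \<le> card (B \<inter> P)"
proof -
  have P: "P \<subseteq> pverts G" using assms tzf_filled_subset by blast
  then have finP: "finite P" using assms by (blast intro: finite_subset)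
  define W where "W = (\<Sum>u\<in>P. weight t u)"
  have "(\<Sum>v\<in>(\<Union>s\<le>t. \<Union>u\<in>P. forcers s u). weight t v) \<le> W"
    unfolding W_def using closed finP tzf_weight_nonneg[OF \<open>0 \<le> \<alpha>\<close>] by (intro sum_mono2) auto
  then have "\<alpha> * (\<Sum>v\<in>(\<Union>s\<le>t. \<Union>u\<in>P. forcers s u). weight t v) \<le> \<alpha> * W"
    by (rule mult_left_mono) fact
  then have "W \<le> card (B \<inter> P) + \<alpha> * W"
    using tzf_total_weight[of P t] assms P by (simp add: W_def)
  then have "(1 - \<alpha>) * W \<le> card (B \<inter> P)"
    by (simp add: algebra_simps)
  moreover have "card P * \<beta> \<le> W"
    unfolding W_def using assms tzf_weight_ge_threshold by (intro sum_bounded_below) auto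
  then have "(1 - \<alpha>) * (card P * \<beta>) \<le> (1 - \<alpha>) * W"
    using assms by (intro mult_left_mono) auto
  ultimately show ?thesis by (simp add: algebra_simps)
qed

end

section \<open>The double broom\<close>

text \<open>
  The parity of a vertex tells which of the hubs \<open>0\<close> and \<open>1\<close> it hangs from. The vertices
  \<open>2, \<dots>, 2L + 1\<close> form the two paths, and those from \<open>2L + 2\<close> on are the leaves.
\<close>

definition broom_parent :: "nat \<Rightarrow> nat \<Rightarrow> nat" where
  "broom_parent L v = (if v = 1 then 0 else if v < 2 * L + 2 then v - 2 else v mod 2)"

text \<open>The guards \<open>0 < v\<close> and \<open>0 < u\<close> exclude the root: truncated
  subtraction gives \<open>broom_parent L 0 = 0\<close>, which would be a loop.\<close>

definition double_broom :: "nat \<Rightarrow> nat \<Rightarrow> nat pair_pre_digraph" where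
  "double_broom L K =
    \<lparr> pverts = {..<2 * L + 2 + 2 * K},
      parcs = {(u, v). u < 2 * L + 2 + 2 * K \<and> v < 2 * L + 2 + 2 * K \<and>
        (0 < v \<and> u = broom_parent L v \<or> 0 < u \<and> v = broom_parent L u)} \<rparr>"

lemma broom_parent_less: "0 < v \<Longrightarrow> broom_parent L v < v"
  by (auto simp: broom_parent_def intro: le_less_trans[of _ 1])

lemma pair_graph_double_broom: "pair_graph (double_broom L K)"
proof -
  have "parcs (double_broom L K) \<subseteq> pverts (double_broom L K) \<times> pverts (double_broom L K)"
    by (auto simp: double_broom_def)
  then have "finite (parcs (double_broom L K))"
    by (rule finite_subset) (simp add: double_broom_def)
  moreover have "symmetric (with_proj (double_broom L K))"
    by (auto simp: symmetric_def double_broom_def sym_def)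
  ultimately show ?thesis
    using broom_parent_less by unfold_locales (auto simp: double_broom_def dest: broom_parent_less[of _ L])
qed

text \<open>Each side fills one vertex per round, first the hub. Vertex \<open>n\<close> is
  \<open>n div 2\<close> steps from its hub, so the weight \<open>K * \<alpha>\<close> of the hub
  has been damped \<open>n div 2\<close> times. Zero weights ahead of the front keep the filled set
  exact.\<close>

lemma double_broom_process:
  fixes \<alpha> \<beta> :: real
  assumes \<alpha>: "0 < \<alpha>" "\<alpha> < 1" and \<beta>: "0 < \<beta>" and K: "\<beta> \<le> K * \<alpha> ^ Suc L"
    and B: "B = {2 * L + 2..<2 * L + 2 + 2 * K}"
  defines "H \<equiv> double_broom L K"
  shows "t \<le> L + 1 \<Longrightarrow> tzf_filled H \<alpha> \<beta> B t = B \<union> {..<2 * t} \<and>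
    (\<forall>n<2 * t. K * \<alpha> ^ Suc (n div 2) \<le> tzf_weight H \<alpha> \<beta> B t n) \<and>
    (\<forall>n. 2 * t \<le> n \<and> n < 2 * L + 2 \<longrightarrow> tzf_weight H \<alpha> \<beta> B t n = 0)"
\<comment> \<open>Strong induction: that a sender has not transmitted before is read off from the
  filled sets of all earlier rounds.\<close>
proof (induction t rule: less_induct)
  case (less t')
  let ?f = "tzf_filled H \<alpha> \<beta> B" and ?w = "tzf_weight H \<alpha> \<beta> B" and ?F = "tzf_forcers H \<alpha> \<beta> B"
  show ?case
  proof (cases t')
    case 0
    then show ?thesis by (auto simp: B)
  next
    case (Suc t)
    have B_iff: "v \<in> B \<longleftrightarrow> 2 * L + 2 \<le> v \<and> v < 2 * L + 2 + 2 * K" for v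
      by (simp add: B)
    have pverts_H: "pverts H = {..<2 * L + 2 + 2 * K}"
      by (simp add: H_def double_broom_def)
    have parcs_H: "(u, v) \<in> parcs H \<longleftrightarrow> u < 2 * L + 2 + 2 * K \<and> v < 2 * L + 2 + 2 * K \<and>
        (0 < v \<and> u = broom_parent L v \<or> 0 < u \<and> v = broom_parent L u)" for u v
      by (simp add: H_def double_broom_def)
    have finB: "finite B" by (simp add: B)
    have tL: "t \<le> L" using less.prems Suc by simp
    have fil: "?f s = B \<union> {..<2 * s}" if "s \<le> t" for s
      using less.IH[of s] that Suc less.prems by simp
    have wlow: "K * \<alpha> ^ Suc (n div 2) \<le> ?w t n" if "n < 2 * t" for n
      using less.IH[of t] that Suc less.prems by simp
    have wzero: "?w t n = 0" if "2 * t \<le> n" "n < 2 * L + 2" for n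
      using less.IH[of t] that Suc less.prems by simp
    have fin: "finite (?F (Suc t) u)" for u
      by (rule finite_subset[OF tzf_forcers_subset]) (simp add: fil finB)
    have nonneg: "0 \<le> ?w t v" for v
      using \<alpha> by (intro tzf_weight_nonneg) simp
    have receive: "(\<Sum>v\<in>S. \<alpha> * ?w t v) \<le> ?w (Suc t) u" if "S \<subseteq> ?F (Suc t) u" for S u
    proof -
      have "(\<Sum>v\<in>S. \<alpha> * ?w t v) \<le> (\<Sum>v\<in>?F (Suc t) u. \<alpha> * ?w t v)"
        using fin that nonneg \<alpha> by (intro sum_mono2) auto
      then show ?thesis
        using nonneg[of u] by (simp add: tzf_weight_Suc)
    qed
    \<comment> \<open>The path neighbours of \<open>u\<close> are at least \<open>2 * t\<close>,
      hence unfilled, and leaves hang only from the hubs.\<close>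
    have none: "?F (Suc t) u = {}" if u: "2 * t + 2 \<le> u" "u < 2 * L + 2" for u
    proof (rule ccontr)
      assume "?F (Suc t) u \<noteq> {}"
      then obtain v where v: "v \<in> ?F (Suc t) u" by blast
      have "v \<in> B \<union> {..<2 * t}" using tzf_forcersD(1)[OF v] fil by simp
      moreover have "0 < u \<and> v = broom_parent L u \<or> 0 < v \<and> u = broom_parent L v"
        using tzf_forcersD(4)[OF v] by (auto simp: pverts_H parcs_H)
      ultimately show False
        using u by (auto simp: broom_parent_def B_iff split: if_splits)
    qed
    have gain: "K * \<alpha> ^ Suc t \<le> ?w (Suc t) u" if u: "u = 2 * t \<or> u = 2 * t + 1" for u
    proof (cases "t = 0")
      case True
      \<comment> \<open>The \<open>K\<close> leaves of hub \<open>u\<close>, whose only neighbour is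
        that hub.\<close>
      define S where "S = (\<lambda>i. 2 * (L + 1 + i) + u) ` {..<K}"
      have cardS: "card S = K"
        unfolding S_def by (subst card_image) (auto simp: inj_on_def)
      have SB: "S \<subseteq> B" using u True by (auto simp: S_def B_iff)
      have SF: "S \<subseteq> ?F (Suc t) u"
      proof
        fix v assume v: "v \<in> S"
        then have "v mod 2 = u" "2 * L + 2 \<le> v" "v < 2 * L + 2 + 2 * K"
          using u True SB by (auto simp: S_def B_iff)
        then have "{x \<in> pverts H - ?f t. (v, x) \<in> parcs H} = {u}"
          using u True tL by (auto simp: fil B_iff pverts_H parcs_H broom_parent_def split: if_splits)
        then show "v \<in> ?F (Suc t) u"
          using v SB True by (auto simp: tzf_forcers.simps(2) fil)
      qed
      have "K * \<alpha> ^ Suc t = (\<Sum>v\<in>S. \<alpha> * ?w t v)"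
        using SB True cardS by (simp add: subset_iff)
      also have "\<dots> \<le> ?w (Suc t) u"
        using SF by (intro receive) auto
      finally show ?thesis .
    next
      case False
      \<comment> \<open>The predecessor of \<open>u\<close> on its side, a hub if
        \<open>t = 1\<close>. All its other neighbours are already filled.\<close>
      define v where "v = u - 2"
      have v: "u = v + 2" "v < 2 * t" "2 * t \<le> v + 2" using u False by (auto simp: v_def)
      have "{x \<in> pverts H - ?f t. (v, x) \<in> parcs H} = {u}"
      proof (intro equalityI subsetI)
        fix x assume x: "x \<in> {x \<in> pverts H - ?f t. (v, x) \<in> parcs H}"
        then have tx: "2 * t \<le> x" "x < 2 * L + 2"
          by (auto simp: fil B_iff pverts_H)
        then have "2 \<le> x" using False by linarith
        have "v = broom_parent L x \<or> 0 < v \<and> x = broom_parent L v"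
          using x by (auto simp: pverts_H parcs_H)
        then have "v = broom_parent L x"
          using v(2) tx(1) broom_parent_less[of v L] by linarith
        then show "x \<in> {u}"
          using v(1) tx(2) \<open>2 \<le> x\<close> by (simp add: broom_parent_def)
      next
        have "v = broom_parent L u" "u < 2 * L + 2" "2 * t \<le> u"
          using v tL by (auto simp: broom_parent_def)
        then show "x \<in> {x \<in> pverts H - ?f t. (v, x) \<in> parcs H}" if "x \<in> {u}" for x
          using that v(1) by (auto simp: fil B_iff pverts_H parcs_H)
      qed
      \<comment> \<open>\<open>v\<close> is unfilled before time \<open>t\<close>, so it has not
        transmitted yet.\<close>
      moreover have "v \<notin> ?F s u'" if "s < Suc t" for s u'
      proof (cases s)
        case (Suc r)
        have "v \<notin> ?f r"
          using v that Suc tL by (auto simp: fil B_iff)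
        then show ?thesis using tzf_forcersD(1)[of v H \<alpha> \<beta> B r u'] Suc by auto
      qed simp
      ultimately have vF: "v \<in> ?F (Suc t) u"
        using v by (auto simp: tzf_forcers.simps(2) fil)
      have "v div 2 = t - 1" using v by presburger
      then have "K * \<alpha> ^ t \<le> ?w t v" using wlow[of v] v False by simp
      then have "\<alpha> * (K * \<alpha> ^ t) \<le> \<alpha> * ?w t v" using \<alpha> by simp
      then have "K * \<alpha> ^ Suc t \<le> (\<Sum>v\<in>{v}. \<alpha> * ?w t v)" by (simp add: algebra_simps)
      also have "\<dots> \<le> ?w (Suc t) u"
        using vF by (intro receive) auto
      finally show ?thesis .
    qed
    have zero: "?w (Suc t) u = 0" if "2 * t + 2 \<le> u" "u < 2 * L + 2" for u
      using none[OF that] wzero[of u] that by (simp add: tzf_weight_Suc)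
    \<comment> \<open>The bound is smallest at the path ends, where \<open>K\<close> was required to
      suffice.\<close>
    have "K * \<alpha> ^ Suc L \<le> K * \<alpha> ^ Suc t"
      using \<alpha> tL by (intro mult_left_mono power_decreasing) auto
    then have enough: "\<beta> \<le> ?w (Suc t) u" if "u = 2 * t \<or> u = 2 * t + 1" for u
      using gain[OF that] K by linarith
    have mem: "u \<in> ?f (Suc t) \<longleftrightarrow> u \<in> B \<union> {..<2 * Suc t}" for u
    proof -
      consider "u \<in> B" | "u < 2 * t" | "u = 2 * t \<or> u = 2 * t + 1"
        | "2 * t + 2 \<le> u" "u < 2 * L + 2" | "u \<notin> pverts H" "u \<notin> B" "2 * L + 2 \<le> u"
        by (auto simp: B_iff pverts_H parcs_H) linarith
      then show ?thesis
      proof cases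
        case 3
        then have "u \<in> pverts H" using tL by (auto simp: pverts_H parcs_H)
        then show ?thesis using 3 enough[of u] by (auto simp: tzf_filled.simps(2))
      next
        case 4
        then have "u \<notin> B" by (simp add: B_iff)
        with 4 show ?thesis using zero[of u] \<beta> by (auto simp: tzf_filled.simps(2) fil)
      qed (use tL in \<open>auto simp: tzf_filled.simps(2) fil\<close>)
    qed
    moreover have "K * \<alpha> ^ Suc (n div 2) \<le> ?w (Suc t) n" if "n < 2 * Suc t" for n
    proof (cases "n < 2 * t")
      case True
      then show ?thesis
        using wlow[of n] tzf_weight_filled[of n H \<alpha> \<beta> B t "Suc t"] by (simp add: fil)
    next
      case False
      then have "n = 2 * t \<or> n = 2 * t + 1" using that by auto
      moreover from this have "n div 2 = t" by presburger
      ultimately show ?thesis using gain[of n] by simp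
    qed
    ultimately show ?thesis
      using Suc zero by (intro conjI) (blast, auto)
  qed
qed

lemma tzf_number_double_broom_le:
  fixes \<alpha> \<beta> :: real
  assumes "0 < \<alpha>" "\<alpha> < 1" "0 < \<beta>" "\<beta> \<le> K * \<alpha> ^ Suc L"
  shows "tzf_number \<alpha> \<beta> (double_broom L K) \<le> 2 * K"
proof -
  let ?B = "{2 * L + 2..<2 * L + 2 + 2 * K}"
  \<comment> \<open>One round for the hubs and one for each of the \<open>L\<close> path
    positions.\<close>
  have "tzf_filled (double_broom L K) \<alpha> \<beta> ?B (L + 1) = pverts (double_broom L K)"
    using double_broom_process[OF assms refl, of "L + 1"] by (auto simp: double_broom_def)
  moreover have "?B \<subseteq> pverts (double_broom L K)"
    by (auto simp: double_broom_def)
  ultimately have "tzf_set \<alpha> \<beta> (double_broom L K) ?B"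
    by (auto simp: tzf_set_def)
  then show ?thesis
    unfolding tzf_number_def by (intro Least_le exI[of _ ?B]) simp
qed

section \<open>The broom after contraction of the hub edge\<close>

lemma pverts_contract_double_broom:
  "pverts (contract_edge (double_broom L K) (0, Suc 0)) = {..<2 * L + 2 + 2 * K} - {1}"
  by (auto simp: contract_edge_def double_broom_def Let_def image_iff)

text \<open>Without the merged hub \<open>0\<close> only two paths, told apart by parity, and
  isolated leaves remain. So a leaf is forced only by \<open>0\<close>, and a path not served by
  \<open>0\<close> receives weight only from itself.\<close>

lemma parcs_contract_double_broom:
  assumes "(v, u) \<in> parcs (contract_edge (double_broom L K) (0, Suc 0))" "2 \<le> u"
  shows "v = 0 \<or> u < 2 * L + 2 \<and> 2 \<le> v \<and> v < 2 * L + 2 \<and> v mod 2 = u mod 2"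
proof -
  obtain v' where v': "v = (if v' = 1 then 0 else v')" "(v', u) \<in> parcs (double_broom L K)"
    using assms unfolding contract_edge_def Let_def
    by (force split: if_splits)
  then have "u = broom_parent L v' \<or> v' = broom_parent L u"
    by (auto simp: double_broom_def)
  moreover have "(n - 2) mod 2 = n mod 2" if "2 \<le> n" for n :: nat
    using that by (simp add: le_mod_geq)
  ultimately show ?thesis
    using v'(1) assms(2) by (auto simp: broom_parent_def not_less split: if_splits)
qed

lemma tzf_number_contract_double_broom_ge:
  fixes \<alpha> \<beta> :: real
  assumes "0 < \<alpha>" "\<alpha> < 1" "0 < \<beta>" "\<beta> < 1" and L: "real p < (1 - \<alpha>) * \<beta> * L"
  shows "2 * K + p \<le> tzf_number \<alpha> \<beta> (contract_edge (double_broom L K) (0, Suc 0))"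
proof -
  let ?G = "contract_edge (double_broom L K) (0, Suc 0)"
  obtain B where B: "tzf_set \<alpha> \<beta> ?G B" "card B = tzf_number \<alpha> \<beta> ?G"
    using tzf_number_attained by blast
  let ?F = "tzf_forcers ?G \<alpha> \<beta> B"
  obtain T where BV: "B \<subseteq> pverts ?G" and T: "tzf_filled ?G \<alpha> \<beta> B T = pverts ?G"
    using B by (auto simp: tzf_set_def)
  have finV: "finite (pverts ?G)" by (simp add: pverts_contract_double_broom)
  have finB: "finite B" using BV finV by (rule finite_subset)
  \<comment> \<open>The targets of the merged hub; it transmits once, so there is at most
    one.\<close>
  define A where "A = {u. \<exists>s. 0 \<in> ?F s u}"
  have A: "u = u'" if "u \<in> A" "u' \<in> A" for u u'
    using that tzf_forcers_unique by (fastforce simp: A_def)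
  define P where "P r = (\<lambda>i. 2 * i + r) ` {1..L}" for r :: nat
  define Q where "Q = {2 * L + 2..<2 * L + 2 + 2 * K}"
  have P_iff: "v \<in> P r \<longleftrightarrow> 2 \<le> v \<and> v < 2 * L + 2 \<and> v mod 2 = r" if "r < 2" for r v
  proof
    assume *: "2 \<le> v \<and> v < 2 * L + 2 \<and> v mod 2 = r"
    then show "v \<in> P r"
      unfolding P_def by (intro image_eqI[of _ _ "v div 2"]) auto
  qed (use that in \<open>auto simp: P_def\<close>)
  \<comment> \<open>The strict inequality for \<open>L\<close> yields \<open>p + 1\<close>; the
    extra vertex pays for a leaf possibly missing from \<open>B\<close>.\<close>
  have path: "p + 1 \<le> card (B \<inter> P r)" if r: "r < 2" and "P r \<inter> A = {}" for r
  proof -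
    have "(1 - \<alpha>) * \<beta> * card (P r) \<le> card (B \<inter> P r)"
    proof (rule tzf_isolated_part_bound[where t = T, OF finV BV])
      show "P r \<subseteq> tzf_filled ?G \<alpha> \<beta> B T"
        by (auto simp: T pverts_contract_double_broom P_iff[OF r])
    next
      fix s u v assume u: "u \<in> P r" and v: "v \<in> ?F s u"
      then have "v \<noteq> 0" using that by (auto simp: A_def)
      then show "v \<in> P r"
        using parcs_contract_double_broom[OF tzf_forcers_arc[OF v]] u by (auto simp: P_iff[OF r])
    qed (use assms in auto)
    moreover have "card (P r) = L"
      unfolding P_def by (subst card_image) (auto simp: inj_on_def)
    ultimately have "real p < card (B \<inter> P r)" using L by simp
    then show ?thesis by simp
  qed
  \<comment> \<open>A leaf outside \<open>B\<close> must be forced, and only the hub can do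
    it.\<close>
  have QA: "Q - B \<subseteq> A"
  proof
    fix u assume u: "u \<in> Q - B"
    then have "u \<in> tzf_filled ?G \<alpha> \<beta> B T" by (auto simp: T pverts_contract_double_broom Q_def)
    then obtain s v where v: "v \<in> ?F s u"
      using tzf_filled_forced[of \<beta> u ?G \<alpha> B T] u assms by auto
    then have "v = 0"
      using parcs_contract_double_broom[OF tzf_forcers_arc[OF v]] u by (auto simp: Q_def)
    with v show "u \<in> A" by (auto simp: A_def)
  qed
  have PQ: "card (B \<inter> P r) + card (B \<inter> Q) \<le> card B" if r: "r < 2" for r
  proof -
    have "card (B \<inter> P r) + card (B \<inter> Q) = card (B \<inter> P r \<union> B \<inter> Q)"
      using finB by (intro card_Un_disjoint[symmetric]) (auto simp: P_iff[OF r] Q_def)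
    also have "\<dots> \<le> card B" using finB by (intro card_mono) auto
    finally show ?thesis .
  qed
  have cardQ: "card Q = 2 * K" by (simp add: Q_def)
  have "2 * K + p \<le> card B"
  proof (cases "Q \<subseteq> B")
    case True
    \<comment> \<open>Two disjoint paths cannot both meet \<open>A\<close>, which has at most one
      element.\<close>
    have "P 0 \<inter> P 1 = {}" by (auto simp: P_iff)
    then obtain r where "r < 2" "P r \<inter> A = {}"
      using A by (metis disjoint_iff one_less_numeral_iff pos2 semiring_norm(76))
    moreover from True have "B \<inter> Q = Q" by blast
    ultimately show ?thesis using path[of r] PQ[of r] cardQ by simp
  next
    case False
    then obtain q where q: "q \<in> Q" "q \<notin> B" by blast
    \<comment> \<open>The hub's single transmission goes to \<open>q\<close>, so neither path gets
      it and \<open>q\<close> is the only missing leaf.\<close>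
    then have Aq: "A = {q}" using QA A by blast
    then have "P 0 \<inter> A = {}" using q by (auto simp: P_iff Q_def)
    moreover have "Q - {q} \<subseteq> B \<inter> Q" using Aq QA by blast
    then have "card (Q - {q}) \<le> card (B \<inter> Q)" using finB by (intro card_mono) auto
    ultimately show ?thesis using path[of 0] PQ[of 0] cardQ q by (simp add: Q_def)
  qed
  with B show ?thesis by simp
qed

theorem theorem5p3p2:
  fixes \<alpha> \<beta> :: real and p :: nat
  assumes "0 < \<alpha>" "\<alpha> < 1" "0 < \<beta>" "\<beta> < 1" "0 < p"
  shows "\<exists>(H :: nat pair_pre_digraph) e. pair_graph H \<and> e \<in> parcs H \<and>
           int (tzf_number \<alpha> \<beta> (contract_edge H e)) - int (tzf_number \<alpha> \<beta> H) \<ge> int p"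
proof -
  have "0 < (1 - \<alpha>) * \<beta>" using assms by simp
  then obtain L :: nat where L: "real p < L * ((1 - \<alpha>) * \<beta>)"
    using reals_Archimedean3 by blast
  \<comment> \<open>\<open>K\<close> is chosen after \<open>L\<close>, to outweigh the damping along
    paths of that length; the lower bound holds for every \<open>K\<close>.\<close>
  have "0 < \<alpha> ^ Suc L" using assms by simp
  then obtain K :: nat where K: "\<beta> < K * \<alpha> ^ Suc L"
    using reals_Archimedean3 by blast
  have "2 * K + p \<le> tzf_number \<alpha> \<beta> (contract_edge (double_broom L K) (0, Suc 0))"
    using assms L by (intro tzf_number_contract_double_broom_ge) (auto simp: algebra_simps)
  moreover have "tzf_number \<alpha> \<beta> (double_broom L K) \<le> 2 * K"
    using assms K by (intro tzf_number_double_broom_le) auto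
  moreover have "(0, Suc 0) \<in> parcs (double_broom L K)"
    by (simp add: double_broom_def broom_parent_def)
  ultimately show ?thesis
    using pair_graph_double_broom by (intro exI[of _ "double_broom L K"] exI[of _ "(0, Suc 0)"]) auto
qed

end
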